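(* Let $A\in\mathbb{R}^{m\times n}$ have rows $a_1^\top,\dots,a_m^\top$, all nonzero, and let $b\in\mathbb{R}^m$ be such that the linear system $Ax=b$ is consistent. Let $x^{(0)}\in\mathbb{R}^n$ and let $x^\star=A^\dagger b+(I-A^\dagger A)x^{(0)}$ denote the orthogonal projection of $x^{(0)}$ onto the solution set of $Ax=b$. Let $\{x^{(k)}\}_{k\ge 0}$ be any iteration sequence generated by the improved greedy randomized Kaczmarz (iGRK) method started at $x^{(0)}$. Then, deterministically (that is, for every realization of the random indices $i_k\in\mathcal{J}_k$), for every $k\ge 1$, $$\|x^{(k)}-x^\star\|_2^2\le\left(1-\frac{\sigma_{\min}^2(A)}{\gamma}\right)^{k-1}\left(1-\frac{\sigma_{\min}^2(A)}{\|A\|_F^2}\right)\|x^{(0)}-x^\star\|_2^2,$$ where $\gamma=\max_{i\in[m]}\sum_{j=1,\,j\ne i}^m\|a_j\|_2^2$.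
   Context: Notation: $[m]=\{1,\dots,m\}$; $a_i\in\mathbb{R}^n$ is the transpose of the $i$-th row of $A$; $b_i$ is the $i$-th entry of $b$; $A^\dagger$ is the Moore–Penrose pseudoinverse; $\|A\|_F$ is the Frobenius norm; $\sigma_{\min}(A)$ is the smallest nonzero singular value of $A$. The iGRK method: starting from $x^{(0)}$, for $k=0,1,2,\dots$: (1) set $\mathcal{N}_k=\{i\in[m]:|\langle a_i,x^{(k)}\rangle-b_i|\ne 0\}$ and $\Gamma_k=\sum_{i\in\mathcal{N}_k}\|a_i\|_2^2$; (2) set $$\mathcal{J}_k=\left\{i\in[m]:\frac{|\langle a_i,x^{(k)}\rangle-b_i|^2}{\|a_i\|_2^2}\ge\frac12\left(\max_{j\in[m]}\frac{|\langle a_j,x^{(k)}\rangle-b_j|^2}{\|a_j\|_2^2}+\frac{\|Ax^{(k)}-b\|_2^2}{\Gamma_k}\right)\right\};$$ (3) select $i_k\in\mathcal{J}_k$ according to an arbitrary probability distribution $(p^{(k)}_i)_{i\in[m]}$ with $p_i^{(k)}=0$ for $i\notin\mathcal{J}_k$, $p_i^{(k)}\ge 0$ for $i\in\mathcal{J}_k$ and $\sum_{i\in\mathcal{J}_k}p_i^{(k)}=1$; (4) set $x^{(k+1)}=x^{(k)}-\frac{\langle a_{i_k},x^{(k)}\rangle-b_{i_k}}{\|a_{i_k}\|_2^2}a_{i_k}$. Conventions: if $Ax^{(k)}=b$, so that $\Gamma_k=0$, the quotient $\|Ax^{(k)}-b\|_2^2/\Gamma_k=0/0$ is read as $0$ (so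 $x^{(k+1)}=x^{(k)}$). A zeroth power equals $1$. If $m=1$, so that $\gamma=0$, the right-hand side of the claim is read as $0$ (its factor $1-\sigma_{\min}^2(A)/\|A\|_F^2$ is $0$). *)

theory Defs
  imports "HOL-Probability.Probability"
begin

section \<open>Singular values and the Frobenius norm\<close>

text \<open>Singular values are the square roots of the eigenvalues of the Gram matrix. For
  \<open>m < n\<close> this set also contains \<open>0\<close>, which need not be among the usual \<open>min m n\<close> singular values;
  the nonzero elements are the usual ones.\<close>

definition singular_values :: "real^'n^'m \<Rightarrow> real set" where
  "singular_values A =
     {sqrt l | l. \<exists>v. v \<noteq> 0 \<and> (transpose A ** A) *v v = l *\<^sub>R v}"

text \<open>For \<open>A = 0\<close> the set is empty and the value unspecified.\<close>

definition sigma_min :: "real^'n^'m \<Rightarrow> real" where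
  "sigma_min A = Min {s \<in> singular_values A. s \<noteq> 0}"

definition frobenius_norm :: "real^'n^'m \<Rightarrow> real" where
  "frobenius_norm A = sqrt (\<Sum>i\<in>UNIV. \<Sum>j\<in>UNIV. (A $ i $ j)\<^sup>2)"

lemma frobenius_norm_eq_norm: "frobenius_norm A = norm A"
  by (simp add: frobenius_norm_def norm_vec_def L2_set_def sum_nonneg)

lemma frobenius_norm_rows: "(frobenius_norm A)\<^sup>2 = (\<Sum>i\<in>UNIV. (norm (row i A))\<^sup>2)"
  by (simp add: frobenius_norm_def norm_vec_def L2_set_def sum_nonneg row_def)

section \<open>The Moore--Penrose pseudoinverse\<close>

definition is_pinv :: "real^'n^'m \<Rightarrow> real^'m^'n \<Rightarrow> bool" where
  "is_pinv A X \<longleftrightarrow>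
     A ** X ** A = A \<and> X ** A ** X = X \<and>
     transpose (A ** X) = A ** X \<and> transpose (X ** A) = X ** A"

definition pinv :: "real^'n^'m \<Rightarrow> real^'m^'n" where
  "pinv A = (THE X. is_pinv A X)"

lemma is_pinv_unique:
  assumes "is_pinv A X" "is_pinv A Y"
  shows "X = Y"
proof -
  note a = assms[unfolded is_pinv_def]
  have AX: "A ** X = A ** Y"
  proof -
    have "A ** X = transpose (A ** X)" using a by simp
    also have "\<dots> = transpose ((A ** Y) ** (A ** X))" using a by (metis matrix_mul_assoc)
    also have "\<dots> = (A ** X) ** (A ** Y)" using a by (metis matrix_transpose_mul)
    also have "\<dots> = A ** Y" using a by (metis matrix_mul_assoc)
    finally show ?thesis .
  qed
  have XA: "X ** A = Y ** A"
  proof -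
    have "X ** A = transpose (X ** A)" using a by simp
    also have "\<dots> = transpose ((X ** A) ** (Y ** A))" using a by (metis matrix_mul_assoc)
    also have "\<dots> = (Y ** A) ** (X ** A)" using a by (metis matrix_transpose_mul)
    also have "\<dots> = Y ** A" using a by (metis matrix_mul_assoc)
    finally show ?thesis .
  qed
  have "X = X ** A ** X" using a by simp
  also have "\<dots> = Y ** (A ** X)" using XA by (metis matrix_mul_assoc)
  also have "\<dots> = Y" using AX a by (metis matrix_mul_assoc)
  finally show ?thesis .
qed

lemma is_pinv_exists:
  fixes A :: "real^'n^'m"
  shows "\<exists>X. is_pinv A X"
proof -
  define T where "T = transpose A"
  have adj: "(A *v x) \<bullet> y = x \<bullet> (T *v y)" for x y
    unfolding T_def by (metis dot_lmul_matrix inner_commute vector_transpose_matrix transpose_transpose)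
  have TA0: "A *v x = 0" if "T *v (A *v x) = 0" for x
    using adj[of x "A *v x"] that by simp
  have AT0: "T *v u = 0" if "A *v (T *v u) = 0" for u
    using adj[of "T *v u" u] that by simp
  define P where "P y w \<longleftrightarrow> w \<in> range ((*v) T) \<and> T *v (A *v w - y) = 0" for y w
  have ex: "\<exists>w. P y w" for y
  proof -
    obtain y0 z where y: "y0 \<in> span (range ((*v) A))"
        "\<And>w. w \<in> span (range ((*v) A)) \<Longrightarrow> orthogonal z w" "y = y0 + z"
      by (metis orthogonal_subspace_decomp_exists)
    have spA: "span (range ((*v) A)) = range ((*v) A)"
      by (simp add: span_eq_iff linear_subspace_image)
    have spT: "span (range ((*v) T)) = range ((*v) T)"
      by (simp add: span_eq_iff linear_subspace_image)
    obtain u where u: "y0 = A *v u" using y(1) spA by auto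
    have "x \<bullet> (T *v z) = 0" for x
      using y(2)[of "A *v x"] spA adj[of x z] by (auto simp: orthogonal_def inner_commute)
    then have Tz: "T *v z = 0" using inner_eq_zero_iff by blast
    obtain w w' where w: "w \<in> span (range ((*v) T))"
        "\<And>v. v \<in> span (range ((*v) T)) \<Longrightarrow> orthogonal w' v" "u = w + w'"
      by (metis orthogonal_subspace_decomp_exists)
    have "w' \<bullet> (T *v v) = 0" for v
      using w(2)[of "T *v v"] spT by (auto simp: orthogonal_def)
    then have "A *v w' = 0" using adj inner_eq_zero_iff by metis
    then have "A *v w = y0" using u w(3) by (simp add: matrix_vector_right_distrib)
    moreover have "y0 - y = - z" using y(3) by simp
    ultimately have "T *v (A *v w - y) = 0"
      using Tz by (simp add: vec.neg)
    then show ?thesis using w(1) spT unfolding P_def by auto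
  qed
  have uniq: "w = w'" if "P y w" "P y w'" for y w w'
  proof -
    have "w \<in> range ((*v) T)" "w' \<in> range ((*v) T)" using that unfolding P_def by blast+
    then obtain u u' where u: "w = T *v u" "w' = T *v u'" by blast
    have "T *v (A *v (w - w')) = 0"
      using that unfolding P_def by (simp add: matrix_vector_mult_diff_distrib)
    then have "A *v (T *v (u - u')) = 0"
      using TA0[of "w - w'"] u by (simp add: matrix_vector_mult_diff_distrib)
    then show ?thesis using AT0[of "u - u'"] u by (simp add: matrix_vector_mult_diff_distrib)
  qed
  obtain g where g: "\<And>y. P y (g y)" using ex by metis
  have "linear g"
  proof (rule linearI)
    fix y z
    obtain u v where "g y = T *v u" "g z = T *v v" using g unfolding P_def by blast
    then have "g y + g z = T *v (u + v)" by (simp add: matrix_vector_right_distrib)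
    then have "g y + g z \<in> range ((*v) T)" by blast
    then have "P (y + z) (g y + g z)"
      using g[of y] g[of z] unfolding P_def
      by (simp add: matrix_vector_mult_diff_distrib matrix_vector_right_distrib)
    then show "g (y + z) = g y + g z" using g uniq by blast
  next
    fix c y
    obtain u where "g y = T *v u" using g unfolding P_def by blast
    then have "c *\<^sub>R g y = T *v (c *\<^sub>R u)" by (simp add: matrix_vector_mult_scaleR)
    then have "c *\<^sub>R g y \<in> range ((*v) T)" by blast
    then have "P (c *\<^sub>R y) (c *\<^sub>R g y)"
      using g[of y] unfolding P_def
      by (simp add: matrix_vector_mult_diff_distrib matrix_vector_mult_scaleR)
    then show "g (c *\<^sub>R y) = c *\<^sub>R g y" using g uniq by blast
  qed
  define X where "X = matrix g"
  have X: "X *v y = g y" for y using \<open>linear g\<close> unfolding X_def by (simp add: matrix_works)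
  have PX: "P y (X *v y)" for y using g X by simp
  have TAX: "T *v (A *v (X *v y)) = T *v y" for y
    using PX[of y] unfolding P_def by (simp add: matrix_vector_mult_diff_distrib)
  have AXA: "A *v (X *v (A *v x)) = A *v x" for x
    using TA0[of "X *v (A *v x) - x"] TAX[of "A *v x"]
    by (simp add: matrix_vector_mult_diff_distrib)
  have XAX: "X *v (A *v (X *v y)) = X *v y" for y
  proof (rule uniq)
    show "P (A *v (X *v y)) (X *v (A *v (X *v y)))" by (rule PX)
    show "P (A *v (X *v y)) (X *v y)" using PX[of y] unfolding P_def by simp
  qed
  have s1: "(A *v (X *v y)) \<bullet> z = (A *v (X *v y)) \<bullet> (A *v (X *v z))" for y z
    using adj TAX by metis
  have s2: "(X *v (A *v x)) \<bullet> z = (X *v (A *v x)) \<bullet> (X *v (A *v z))" for x z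
  proof -
    obtain u where "X *v (A *v x) = T *v u" using PX unfolding P_def by blast
    then show ?thesis using adj AXA by (metis inner_commute)
  qed
  have sym: "transpose M = M" if "\<And>y z. (M *v y) \<bullet> z = y \<bullet> (M *v z)" for M :: "real^'k^'k"
  proof -
    have "y \<bullet> (transpose M *v z) = y \<bullet> (M *v z)" for y z
      using that by (metis dot_lmul_matrix inner_commute vector_transpose_matrix transpose_transpose)
    then show ?thesis by (metis matrix_eq vector_eq_rdot inner_commute)
  qed
  have "A ** X ** A = A" "X ** A ** X = X"
    using AXA XAX by (auto simp: matrix_eq simp flip: matrix_vector_mul_assoc)
  moreover have "transpose (A ** X) = A ** X"
    by (rule sym) (metis s1 inner_commute matrix_vector_mul_assoc)
  moreover have "transpose (X ** A) = X ** A"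
    by (rule sym) (metis s2 inner_commute matrix_vector_mul_assoc)
  ultimately show ?thesis unfolding is_pinv_def by blast
qed

lemma is_pinv_pinv: "is_pinv A (pinv A)"
  unfolding pinv_def using is_pinv_exists is_pinv_unique by (metis theI)

section \<open>The improved greedy randomized Kaczmarz method\<close>

definition residual :: "real^'n^'m \<Rightarrow> real^'m \<Rightarrow> real^'n \<Rightarrow> 'm \<Rightarrow> real" where
  "residual A b x i = row i A \<bullet> x - b $ i"

definition active_rows :: "real^'n^'m \<Rightarrow> real^'m \<Rightarrow> real^'n \<Rightarrow> 'm set" where
  "active_rows A b x = {i. \<bar>residual A b x i\<bar> \<noteq> 0}"

definition active_mass :: "real^'n^'m \<Rightarrow> real^'m \<Rightarrow> real^'n \<Rightarrow> real" where
  "active_mass A b x = (\<Sum>i\<in>active_rows A b x. (norm (row i A))\<^sup>2)"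

text \<open>If \<open>x\<close> solves the system, the quotient by \<open>active_mass\<close> is \<open>0 / 0 = 0\<close>, so that all
  rows are selected.\<close>

definition greedy_rows :: "real^'n^'m \<Rightarrow> real^'m \<Rightarrow> real^'n \<Rightarrow> 'm set" where
  "greedy_rows A b x =
     {i. \<bar>residual A b x i\<bar>\<^sup>2 / (norm (row i A))\<^sup>2 \<ge>
         1 / 2 * ((MAX j\<in>UNIV. \<bar>residual A b x j\<bar>\<^sup>2 / (norm (row j A))\<^sup>2)
                  + (norm (A *v x - b))\<^sup>2 / active_mass A b x)}"

definition kaczmarz_step :: "real^'n^'m \<Rightarrow> real^'m \<Rightarrow> 'm \<Rightarrow> real^'n \<Rightarrow> real^'n" where
  "kaczmarz_step A b i x = x - (residual A b x i / (norm (row i A))\<^sup>2) *\<^sub>R row i A"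

text \<open>A sequence of iterates is a realization of the method: in each step some probability
  distribution \<open>p\<close> supported in the greedy set is chosen, and \<open>i\<close> is a possible outcome of
  drawing from \<open>p\<close>. Since \<open>p\<close> is arbitrary, every index in the greedy set may be drawn,
  see \<open>igrk_sequence_iff\<close>.\<close>

definition igrk_sequence :: "real^'n^'m \<Rightarrow> real^'m \<Rightarrow> (nat \<Rightarrow> real^'n) \<Rightarrow> bool" where
  "igrk_sequence A b x \<longleftrightarrow>
     (\<forall>k. \<exists>p i. set_pmf p \<subseteq> greedy_rows A b (x k) \<and> i \<in> set_pmf p \<and>
               x (Suc k) = kaczmarz_step A b i (x k))"

lemma igrk_sequence_iff:
  "igrk_sequence A b x \<longleftrightarrow>
     (\<forall>k. \<exists>i\<in>greedy_rows A b (x k). x (Suc k) = kaczmarz_step A b i (x k))"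
proof
  assume "\<forall>k. \<exists>i\<in>greedy_rows A b (x k). x (Suc k) = kaczmarz_step A b i (x k)"
  then show "igrk_sequence A b x"
    unfolding igrk_sequence_def
    by (metis empty_subsetI insert_subset set_return_pmf singletonI)
qed (unfold igrk_sequence_def, blast)

text \<open>If there is only one row, this is \<open>0\<close>, and so is every quotient by it.\<close>

definition max_deleted_mass :: "real^'n^'m \<Rightarrow> real" where
  "max_deleted_mass A = (MAX i\<in>UNIV. \<Sum>j\<in>UNIV - {i}. (norm (row j A))\<^sup>2)"

end

theory Submission
  imports Defs
begin

text \<open>The row used in a step has residual \<open>0\<close> afterwards. Hence the mass of the active rows is at most \<open>\<gamma>\<close> from the second step on. As the
  largest scaled residual dominates the weighted mean \<open>\<parallel>A x - b\<parallel>\<^sup>2 / \<Gamma>\<close>, every greedy step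
  decreases the squared error by at least this mean, and \<open>\<parallel>A e\<parallel> \<ge> \<sigma>\<^sub>m\<^sub>i\<^sub>n \<parallel>e\<parallel>\<close> on the row space, to
  which all errors belong. The factor \<open>1 - \<sigma>\<^sup>2 / \<gamma>\<close> can be negative only if all rows are parallel,
  and then the other factor vanishes.\<close>

section \<open>The smallest singular value\<close>

lemma row_inner_eq: "row i A \<bullet> v = (A *v v) $ i"
  for A :: "real^'n^'m"
  by (simp add: matrix_vector_mul_component row_def)

lemma norm_matrix_vector_sq: "(norm (A *v v))\<^sup>2 = (\<Sum>i\<in>UNIV. (row i A \<bullet> v)\<^sup>2)"
  for A :: "real^'n^'m"
  by (simp add: row_inner_eq norm_vec_def L2_set_def sum_nonneg)

lemma inner_transpose_matrix_vector: "(A *v v) \<bullet> w = v \<bullet> (transpose A *v w)"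
  for A :: "real^'n^'m"
  by (metis dot_lmul_matrix inner_commute vector_transpose_matrix transpose_transpose)

lemma gram_inner: "((transpose A ** A) *v v) \<bullet> w = (A *v v) \<bullet> (A *v w)"
  for A :: "real^'n^'m"
  by (metis inner_commute inner_transpose_matrix_vector matrix_vector_mul_assoc)

lemma gram_eigenvalue:
  fixes A :: "real^'n^'m"
  assumes "(transpose A ** A) *v v = l *\<^sub>R v"
  shows "(norm (A *v v))\<^sup>2 = l * (norm v)\<^sup>2"
  using gram_inner[of A v v] assms by (simp add: power2_norm_eq_inner)

text \<open>The Gram matrix is symmetric, so eigenvectors for distinct eigenvalues are orthogonal.
  Choosing one eigenvector per eigenvalue gives an independent, hence finite, family. Finiteness
  gives the \<open>Min\<close> in \<open>sigma_min\<close> its meaning.\<close>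

lemma finite_singular_values: "finite (singular_values A)"
  for A :: "real^'n^'m"
proof -
  let ?E = "{l. \<exists>v. v \<noteq> 0 \<and> (transpose A ** A) *v v = l *\<^sub>R v}"
  have "\<forall>l\<in>?E. \<exists>v. v \<noteq> 0 \<and> (transpose A ** A) *v v = l *\<^sub>R v" by blast
  from bchoice[OF this] obtain f
    where f: "\<And>l. l \<in> ?E \<Longrightarrow> f l \<noteq> 0 \<and> (transpose A ** A) *v f l = l *\<^sub>R f l"
    by blast
  have orth: "f l \<bullet> f l' = 0" if "l \<in> ?E" "l' \<in> ?E" "l \<noteq> l'" for l l'
  proof -
    have "l * (f l \<bullet> f l') = ((transpose A ** A) *v f l) \<bullet> f l'"
      using f[OF that(1)] by simp
    also have "\<dots> = ((transpose A ** A) *v f l') \<bullet> f l"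
      unfolding gram_inner by (rule inner_commute)
    also have "\<dots> = l' * (f l \<bullet> f l')"
      using f[OF that(2)] by (simp add: inner_commute)
    finally show ?thesis using that(3) by simp
  qed
  have inj: "inj_on f ?E"
  proof (rule inj_onI, rule ccontr)
    fix l l' assume h: "l \<in> ?E" "l' \<in> ?E" "f l = f l'" "l \<noteq> l'"
    then show False using orth[OF h(1,2,4)] f[OF h(1)] by simp
  qed
  have "independent (f ` ?E)"
  proof (rule pairwise_orthogonal_independent)
    show "pairwise orthogonal (f ` ?E)"
      unfolding pairwise_image orthogonal_def
      by (rule pairwiseI) (use orth in blast)
    show "0 \<notin> f ` ?E" using f by force
  qed
  then have "finite ?E"
    using finite_imageD[OF independent_imp_finite inj] by blast
  moreover have "singular_values A = sqrt ` ?E"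
    unfolding singular_values_def by blast
  ultimately show ?thesis by simp
qed

text \<open>This has content because \<open>sqrt\<close> in HOL is negative on negative arguments:
  it rests on the Gram eigenvalues being nonnegative.\<close>

lemma singular_values_nonneg: "s \<in> singular_values A \<Longrightarrow> s \<ge> 0"
  for A :: "real^'n^'m"
proof -
  assume "s \<in> singular_values A"
  then obtain l v where l: "s = sqrt l" "v \<noteq> 0" "(transpose A ** A) *v v = l *\<^sub>R v"
    unfolding singular_values_def by blast
  have "0 \<le> l * (norm v)\<^sup>2" using gram_eigenvalue[OF l(3)] by (metis zero_le_power2)
  then show ?thesis using l by (simp add: zero_le_mult_iff)
qed

section \<open>The row space and the Rayleigh quotient on it\<close>

abbreviation row_space :: "real^'n^'m \<Rightarrow> (real^'n) set" where
  "row_space A \<equiv> range ((*v) (transpose A))"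

lemma subspace_row_space: "subspace (row_space A)" for A :: "real^'n^'m"
  by (rule linear_subspace_image[OF matrix_vector_mul_linear subspace_UNIV])

lemma row_in_row_space: "row i A \<in> row_space A" for A :: "real^'n^'m"
proof -
  have "row i A = transpose A *v axis i 1"
    by (simp add: matrix_vector_mult_basis column_transpose)
  then show ?thesis by blast
qed

lemma row_space_kernel:
  fixes A :: "real^'n^'m"
  assumes "v \<in> row_space A" "A *v v = 0"
  shows "v = 0"
proof -
  obtain u where "v = transpose A *v u" using assms(1) by blast
  then have "v \<bullet> v = (A *v v) \<bullet> u" by (simp add: inner_transpose_matrix_vector)
  then show ?thesis using assms(2) by simp
qed

text \<open>First-order condition at a minimum: for small \<open>t\<close> of suitable sign a
  nonzero linear term would outweigh the quadratic one.\<close>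

lemma psd_form_zero:
  fixes c d :: real
  assumes "\<And>t. 0 \<le> 2 * t * c + t\<^sup>2 * d"
  shows "c = 0"
proof (rule ccontr)
  assume "c \<noteq> 0"
  \<comment> \<open>At \<open>t = - c / e\<close> the form equals
    \<open>(c / e)^2 * (d - 2 * e)\<close>, which is negative as soon as \<open>e\<close> is
    positive and exceeds \<open>d\<close>.\<close>
  define e where "e = 1 + \<bar>d\<bar>"
  have e: "e > 0" "d < e" unfolding e_def by auto
  have "0 \<le> 2 * (- c / e) * c + (- c / e)\<^sup>2 * d" by (rule assms)
  also have "\<dots> = c\<^sup>2 / e\<^sup>2 * (d - 2 * e)"
    using e by (simp add: field_simps power2_eq_square)
  also have "\<dots> < 0" using e \<open>c \<noteq> 0\<close> by (intro mult_pos_neg) auto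
  finally show False by simp
qed

text \<open>A minimiser of the Rayleigh quotient over the row space is an eigenvector.\<close>

lemma row_space_min_eigenvector:
  fixes A :: "real^'n^'m"
  assumes "u \<in> row_space A" "u \<noteq> 0"
  obtains v where "v \<in> row_space A" "norm v = 1"
    "(transpose A ** A) *v v = (norm (A *v v))\<^sup>2 *\<^sub>R v"
    "\<And>w. w \<in> row_space A \<Longrightarrow> (norm (A *v v))\<^sup>2 * (norm w)\<^sup>2 \<le> (norm (A *v w))\<^sup>2"
proof -
  let ?S = "sphere 0 1 \<inter> row_space A"
  note sub = subspace_row_space[of A]
  have normed: "inverse (norm w) *\<^sub>R w \<in> ?S" if "w \<in> row_space A" "w \<noteq> 0" for w
    using that subspace_scale[OF sub] by auto
  have "compact ?S" using closed_subspace[OF sub] by (intro compact_Int_closed) auto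
  moreover have "?S \<noteq> {}" using normed assms by blast
  moreover have "continuous_on ?S (\<lambda>v. (norm (A *v v))\<^sup>2)"
    by (intro continuous_intros matrix_vector_mult_linear_continuous_on)
  ultimately obtain v where v: "v \<in> ?S" "\<And>w. w \<in> ?S \<Longrightarrow> (norm (A *v v))\<^sup>2 \<le> (norm (A *v w))\<^sup>2"
    using continuous_attains_inf by (metis (no_types, lifting))
  define l where "l = (norm (A *v v))\<^sup>2"
  have nv: "norm v = 1" "v \<in> row_space A" using v(1) by auto
  have min: "l * (norm w)\<^sup>2 \<le> (norm (A *v w))\<^sup>2" if "w \<in> row_space A" for w
  proof (cases "w = 0")
    case False
    then have "l \<le> (norm (A *v (inverse (norm w) *\<^sub>R w)))\<^sup>2"
      unfolding l_def using v(2) normed that by blast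
    then show ?thesis using False
      by (simp add: matrix_vector_mult_scaleR power_mult_distrib field_simps)
  qed simp
  define z where "z = (transpose A ** A) *v v - l *\<^sub>R v"
  have zV: "z \<in> row_space A"
    unfolding z_def using nv(2) sub
    by (metis matrix_vector_mul_assoc rangeI subspace_diff subspace_scale)
  \<comment> \<open>Minimality is tested on the perturbations \<open>v + t *\<^sub>R w\<close>; the
    linear coefficient in \<open>t\<close> is twice \<open>z \<bullet> w\<close>. Since
    \<open>z\<close> itself lies in the row space, taking \<open>w = z\<close> then yields
    \<open>z = 0\<close>.\<close>
  have "z \<bullet> w = 0" if w: "w \<in> row_space A" for w
  proof (rule psd_form_zero)
    fix t
    have le: "l * (norm (v + t *\<^sub>R w))\<^sup>2 \<le> (norm (A *v (v + t *\<^sub>R w)))\<^sup>2"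
      using min nv(2) w sub by (metis subspace_add subspace_scale)
    have Aq: "(norm (A *v (v + t *\<^sub>R w)))\<^sup>2
        = l + 2 * t * ((A *v v) \<bullet> (A *v w)) + t\<^sup>2 * (norm (A *v w))\<^sup>2"
      unfolding l_def power2_norm_eq_inner
      by (simp add: matrix_vector_right_distrib matrix_vector_mult_scaleR inner_commute
          algebra_simps power2_eq_square)
    have q: "(norm (v + t *\<^sub>R w))\<^sup>2 = 1 + 2 * t * (v \<bullet> w) + t\<^sup>2 * (norm w)\<^sup>2"
      using nv(1) unfolding power2_norm_eq_inner
      by (simp add: norm_eq_1 inner_commute algebra_simps power2_eq_square)
    have zw: "z \<bullet> w = (A *v v) \<bullet> (A *v w) - l * (v \<bullet> w)"
      unfolding z_def by (simp add: inner_diff_left gram_inner)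
    show "0 \<le> 2 * t * (z \<bullet> w) + t\<^sup>2 * ((norm (A *v w))\<^sup>2 - l * (norm w)\<^sup>2)"
      using le unfolding Aq q zw by (simp add: algebra_simps)
  qed
  then have "z = 0" using zV by (metis inner_eq_zero_iff)
  then show thesis using that[of v] nv min unfolding z_def l_def by simp
qed

text \<open>The minimal Rayleigh quotient is the square of a singular value, which is nonzero
  because \<open>A\<close> is injective on its row space. This both makes the set under the
  \<open>Min\<close> of \<open>sigma_min\<close> nonempty and bounds that minimum from
  above.\<close>

lemma row_space_singular_value:
  fixes A :: "real^'n^'m"
  assumes "u \<in> row_space A" "u \<noteq> 0"
  shows "\<exists>t\<in>singular_values A. t \<noteq> 0 \<and>
    (\<forall>w\<in>row_space A. t\<^sup>2 * (norm w)\<^sup>2 \<le> (norm (A *v w))\<^sup>2)"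
proof (rule row_space_min_eigenvector[OF assms])
  fix v assume v: "v \<in> row_space A" "norm v = 1"
    "(transpose A ** A) *v v = (norm (A *v v))\<^sup>2 *\<^sub>R v"
    "\<And>w. w \<in> row_space A \<Longrightarrow> (norm (A *v v))\<^sup>2 * (norm w)\<^sup>2 \<le> (norm (A *v w))\<^sup>2"
  have "v \<noteq> 0" using v(2) by auto
  then have "sqrt ((norm (A *v v))\<^sup>2) \<in> singular_values A"
    unfolding singular_values_def using v(3) by blast
  moreover have "norm (A *v v) \<noteq> 0" using row_space_kernel v(1) \<open>v \<noteq> 0\<close> by auto
  ultimately show ?thesis using v(4) by (intro bexI[of _ "norm (A *v v)"]) auto
qed

lemma sigma_min_bound:
  fixes A :: "real^'n^'m"
  assumes "w \<in> row_space A"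
  shows "(sigma_min A)\<^sup>2 * (norm w)\<^sup>2 \<le> (norm (A *v w))\<^sup>2"
\<comment> \<open>The case \<open>w = 0\<close> includes \<open>A = 0\<close>, where
  \<open>sigma_min A\<close> is unspecified.\<close>
proof (cases "w = 0")
  case False
  obtain t where t: "t \<in> singular_values A" "t \<noteq> 0"
    "t\<^sup>2 * (norm w)\<^sup>2 \<le> (norm (A *v w))\<^sup>2"
    using row_space_singular_value[OF assms False] assms by metis
  let ?S = "{s \<in> singular_values A. s \<noteq> 0}"
  have fin: "finite ?S" using finite_singular_values[of A] by simp
  have "sigma_min A \<in> ?S"
    unfolding sigma_min_def using t by (intro Min_in fin) blast
  moreover have "sigma_min A \<le> t"
    unfolding sigma_min_def using t by (intro Min_le fin) simp
  ultimately have "(sigma_min A)\<^sup>2 \<le> t\<^sup>2"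
    using singular_values_nonneg by (auto intro: power_mono)
  then have "(sigma_min A)\<^sup>2 * (norm w)\<^sup>2 \<le> t\<^sup>2 * (norm w)\<^sup>2"
    by (rule mult_right_mono) simp
  then show ?thesis using t(3) by linarith
qed simp

lemma sigma_min_eigenvector:
  fixes A :: "real^'n^'m"
  assumes "row i A \<noteq> 0"
  obtains v where "v \<in> row_space A" "v \<noteq> 0" "(norm (A *v v))\<^sup>2 = (sigma_min A)\<^sup>2 * (norm v)\<^sup>2"
proof -
  let ?S = "{s \<in> singular_values A. s \<noteq> 0}"
  obtain t where "t \<in> singular_values A" "t \<noteq> 0"
    using row_space_singular_value[OF row_in_row_space assms] by metis
  then have S: "sigma_min A \<in> ?S"
    unfolding sigma_min_def using finite_singular_values[of A] by (intro Min_in) auto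
  then obtain l v where lv: "sigma_min A = sqrt l" "l \<noteq> 0" "v \<noteq> 0"
      "(transpose A ** A) *v v = l *\<^sub>R v"
    unfolding singular_values_def by auto
  have "l \<ge> 0"
    using S singular_values_nonneg[of "sigma_min A" A] lv(1) by simp
  \<comment> \<open>Dividing the eigenvalue equation by \<open>l \<noteq> 0\<close> exhibits
    \<open>v\<close> as an image under the transpose.\<close>
  have "transpose A *v ((1 / l) *\<^sub>R (A *v v)) = v"
    using lv by (simp add: matrix_vector_mult_scaleR matrix_vector_mul_assoc)
  then have "v \<in> row_space A" by (metis rangeI)
  then show thesis
    using that lv gram_eigenvalue[OF lv(4)] \<open>l \<ge> 0\<close> by simp
qed

section \<open>The smallest singular value against the mass left after deleting a row\<close>

lemma max_deleted_mass_ge: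
  fixes A :: "real^'n^'m"
  shows "(\<Sum>j\<in>UNIV - {i}. (norm (row j A))\<^sup>2) \<le> max_deleted_mass A"
  unfolding max_deleted_mass_def by (rule Max_ge) auto

lemma row_inner_sq_le: "(row j A \<bullet> v)\<^sup>2 \<le> (norm (row j A))\<^sup>2 * (norm v)\<^sup>2"
  for A :: "real^'n^'m"
  using Cauchy_Schwarz_ineq[of "row j A" v] by (simp add: power2_norm_eq_inner)

text \<open>The first alternative holds unless the row space is a line: a nonzero vector of the row space
  orthogonal to the row \<open>i\<close> is not affected by deleting that row.\<close>

lemma sigma_min_sq_cases:
  fixes A :: "real^'n^'m"
  assumes nz: "\<And>i. row i A \<noteq> 0"
  shows "(sigma_min A)\<^sup>2 \<le> max_deleted_mass A \<or> (sigma_min A)\<^sup>2 = (frobenius_norm A)\<^sup>2"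
proof (cases "\<exists>i v. v \<in> row_space A \<and> v \<noteq> 0 \<and> row i A \<bullet> v = 0")
  case True
  then obtain i v where v: "v \<in> row_space A" "v \<noteq> 0" "row i A \<bullet> v = 0" by blast
  have "(sigma_min A)\<^sup>2 * (norm v)\<^sup>2 \<le> (\<Sum>j\<in>UNIV. (row j A \<bullet> v)\<^sup>2)"
    using sigma_min_bound[OF v(1)] by (simp add: norm_matrix_vector_sq)
  also have "\<dots> = (\<Sum>j\<in>UNIV - {i}. (row j A \<bullet> v)\<^sup>2)"
    using v(3) by (subst sum.remove[of _ i]) auto
  also have "\<dots> \<le> (\<Sum>j\<in>UNIV - {i}. (norm (row j A))\<^sup>2 * (norm v)\<^sup>2)"
    by (intro sum_mono row_inner_sq_le)
  also have "\<dots> \<le> max_deleted_mass A * (norm v)\<^sup>2"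
    unfolding sum_distrib_right[symmetric] by (intro mult_right_mono max_deleted_mass_ge) simp
  finally show ?thesis using v(2) by simp
next
  case False
  obtain v where v: "v \<in> row_space A" "v \<noteq> 0"
    "(norm (A *v v))\<^sup>2 = (sigma_min A)\<^sup>2 * (norm v)\<^sup>2"
    using sigma_min_eigenvector[OF nz] by blast
  \<comment> \<open>Subtracting from \<open>v\<close> its component along row \<open>j\<close>
    leaves a vector of the row space orthogonal to that row, which is 0 in this case. So
    \<open>v\<close> is parallel to every row and Cauchy-Schwarz becomes an equality.\<close>
  have "(row j A \<bullet> v)\<^sup>2 = (norm (row j A))\<^sup>2 * (norm v)\<^sup>2" for j
  proof -
    define z where "z = v - ((row j A \<bullet> v) / (norm (row j A))\<^sup>2) *\<^sub>R row j A"
    have "z \<in> row_space A" unfolding z_def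
      using v(1) row_in_row_space[of j A] subspace_row_space[of A]
      by (metis subspace_diff subspace_scale)
    moreover have "row j A \<bullet> z = 0"
      unfolding z_def using nz[of j] by (simp add: inner_diff_right power2_norm_eq_inner)
    ultimately have "z = 0" using False by blast
    then have "v \<bullet> v = ((row j A \<bullet> v) / (norm (row j A))\<^sup>2) * (row j A \<bullet> v)"
      unfolding z_def by (metis eq_iff_diff_eq_0 inner_scaleR_left)
    then have "(norm v)\<^sup>2 = (row j A \<bullet> v)\<^sup>2 / (norm (row j A))\<^sup>2"
      by (simp add: power2_norm_eq_inner[of v] power2_eq_square[of "row j A \<bullet> v"])
    then show ?thesis using nz[of j] by simp
  qed
  then have "(norm (A *v v))\<^sup>2 = (frobenius_norm A)\<^sup>2 * (norm v)\<^sup>2"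
    by (simp add: norm_matrix_vector_sq frobenius_norm_rows sum_distrib_right)
  then show ?thesis using v by simp
qed

section \<open>The greedy step\<close>

lemma residual_error:
  fixes A :: "real^'n^'m"
  assumes "A *v s = b"
  shows "residual A b y i = row i A \<bullet> (y - s)"
  using assms unfolding residual_def by (simp add: row_inner_eq inner_diff_right)

text \<open>Pythagoras: the step removes from the error exactly its orthogonal component along row
  \<open>i\<close>.\<close>

lemma kaczmarz_step_error:
  fixes A :: "real^'n^'m"
  assumes "A *v s = b" "row i A \<noteq> 0"
  shows "(norm (kaczmarz_step A b i y - s))\<^sup>2
           = (norm (y - s))\<^sup>2 - \<bar>residual A b y i\<bar>\<^sup>2 / (norm (row i A))\<^sup>2"
proof -
  define a e where "a = row i A" and "e = y - s"
  have k: "kaczmarz_step A b i y - s = e - ((a \<bullet> e) / (a \<bullet> a)) *\<^sub>R a"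
    unfolding kaczmarz_step_def residual_error[OF assms(1)] a_def e_def
    by (simp add: power2_norm_eq_inner)
  have "(e - ((a \<bullet> e) / (a \<bullet> a)) *\<^sub>R a) \<bullet> (e - ((a \<bullet> e) / (a \<bullet> a)) *\<^sub>R a)
      = e \<bullet> e - (a \<bullet> e)\<^sup>2 / (a \<bullet> a)"
    using assms(2) unfolding a_def[symmetric]
    by (simp add: inner_diff_left inner_diff_right inner_commute field_simps power2_eq_square)
  then show ?thesis
    unfolding power2_norm_eq_inner k residual_error[OF assms(1)]
    by (simp add: a_def e_def)
qed

lemma kaczmarz_step_row_space:
  fixes A :: "real^'n^'m"
  assumes "y - s \<in> row_space A"
  shows "kaczmarz_step A b i y - s \<in> row_space A"
proof -
  have "kaczmarz_step A b i y - s
      = (y - s) - (residual A b y i / (norm (row i A))\<^sup>2) *\<^sub>R row i A"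
    unfolding kaczmarz_step_def by simp
  then show ?thesis
    using assms row_in_row_space[of i A] subspace_row_space[of A]
    by (metis subspace_diff subspace_scale)
qed

lemma residual_after_step:
  fixes A :: "real^'n^'m"
  assumes "row i A \<noteq> 0"
  shows "residual A b (kaczmarz_step A b i y) i = 0"
  using assms unfolding residual_def kaczmarz_step_def
  by (simp add: inner_diff_right power2_norm_eq_inner)

lemma residual_norm: "(norm (A *v y - b))\<^sup>2 = (\<Sum>i\<in>active_rows A b y. \<bar>residual A b y i\<bar>\<^sup>2)"
  for A :: "real^'n^'m"
proof -
  have "(norm (A *v y - b))\<^sup>2 = (\<Sum>i\<in>UNIV. \<bar>residual A b y i\<bar>\<^sup>2)"
    by (simp add: residual_def row_inner_eq norm_vec_def L2_set_def sum_nonneg)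
  also have "\<dots> = (\<Sum>i\<in>active_rows A b y. \<bar>residual A b y i\<bar>\<^sup>2)"
    by (rule sum.mono_neutral_right) (auto simp: active_rows_def)
  finally show ?thesis .
qed

lemma active_mass_nonneg: "active_mass A b y \<ge> 0" for A :: "real^'n^'m"
  unfolding active_mass_def by (simp add: sum_nonneg)

text \<open>The greedy threshold is the midpoint of the maximal scaled residual and a weighted mean
  of scaled residuals. The mean does not exceed the maximum, so the midpoint is at least the
  mean.\<close>

lemma greedy_rows_residual:
  fixes A :: "real^'n^'m"
  assumes nz: "\<And>i. row i A \<noteq> 0" and "i \<in> greedy_rows A b y"
  shows "(norm (A *v y - b))\<^sup>2 / active_mass A b y \<le> \<bar>residual A b y i\<bar>\<^sup>2 / (norm (row i A))\<^sup>2"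
proof -
  let ?q = "\<lambda>j. \<bar>residual A b y j\<bar>\<^sup>2 / (norm (row j A))\<^sup>2"
  define M where "M = (MAX j\<in>UNIV. ?q j)"
  have M: "?q j \<le> M" for j unfolding M_def by (rule Max_ge) auto
  have "(norm (A *v y - b))\<^sup>2 = (\<Sum>j\<in>active_rows A b y. ?q j * (norm (row j A))\<^sup>2)"
    unfolding residual_norm using nz by (intro sum.cong) auto
  also have "\<dots> \<le> (\<Sum>j\<in>active_rows A b y. M * (norm (row j A))\<^sup>2)"
    using M by (intro sum_mono mult_right_mono) auto
  also have "\<dots> = M * active_mass A b y"
    by (simp add: active_mass_def sum_distrib_left)
  finally have *: "(norm (A *v y - b))\<^sup>2 \<le> M * active_mass A b y" .
  have "0 \<le> ?q i" by simp
  then have "M \<ge> 0" using M[of i] by linarith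
  \<comment> \<open>If the active mass is 0, the quotient is 0 by the HOL convention and
    \<open>M \<ge> 0\<close> suffices.\<close>
  have "(norm (A *v y - b))\<^sup>2 / active_mass A b y \<le> M"
  proof (cases "active_mass A b y = 0")
    case False
    then show ?thesis
      using * active_mass_nonneg[of A b y] by (simp add: pos_divide_le_eq)
  qed (use \<open>M \<ge> 0\<close> in simp)
  moreover have "?q i \<ge> 1 / 2 * (M + (norm (A *v y - b))\<^sup>2 / active_mass A b y)"
    using assms(2) unfolding greedy_rows_def M_def by simp
  moreover have "X \<le> Q" if "X \<le> M" "Q \<ge> 1 / 2 * (M + X)" for X Q :: real
    using that by simp
  ultimately show ?thesis by blast
qed

text \<open>The bound \<open>c\<close> is left open to serve both the first step, with the squared
  Frobenius norm, and all later ones, with the maximal deleted mass. The condition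
  \<open>y \<noteq> s\<close> makes the active mass, and hence \<open>c\<close>, positive.\<close>

lemma greedy_step_contraction:
  fixes A :: "real^'n^'m"
  assumes nz: "\<And>i. row i A \<noteq> 0" and s: "A *v s = b" and i: "i \<in> greedy_rows A b y"
    and e: "y - s \<in> row_space A" "y \<noteq> s" and c: "active_mass A b y \<le> c"
  shows "(norm (kaczmarz_step A b i y - s))\<^sup>2
           \<le> (1 - (sigma_min A)\<^sup>2 / c) * (norm (y - s))\<^sup>2"
proof -
  have Ae: "A *v y - b = A *v (y - s)"
    using s by (simp add: matrix_vector_mult_diff_distrib)
  have "A *v y - b \<noteq> 0" using row_space_kernel[OF e(1)] e(2) Ae by auto
  then have "active_rows A b y \<noteq> {}"
    using residual_norm[of A y b] by auto
  then have pos: "active_mass A b y > 0"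
    unfolding active_mass_def using nz by (intro sum_pos) auto
  have "(sigma_min A)\<^sup>2 * (norm (y - s))\<^sup>2 / c \<le> (norm (A *v y - b))\<^sup>2 / active_mass A b y"
    using sigma_min_bound[OF e(1)] pos c unfolding Ae by (intro frac_le) auto
  also have "\<dots> \<le> \<bar>residual A b y i\<bar>\<^sup>2 / (norm (row i A))\<^sup>2"
    by (rule greedy_rows_residual[OF nz i])
  finally show ?thesis
    unfolding kaczmarz_step_error[OF s nz] by (simp add: algebra_simps)
qed

lemma active_mass_le_frobenius:
  fixes A :: "real^'n^'m"
  shows "active_mass A b y \<le> (frobenius_norm A)\<^sup>2"
  unfolding active_mass_def frobenius_norm_rows by (rule sum_mono2) auto

lemma active_mass_le_max_deleted:
  fixes A :: "real^'n^'m"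
  assumes "residual A b y i = 0"
  shows "active_mass A b y \<le> max_deleted_mass A"
proof -
  have "active_mass A b y \<le> (\<Sum>j\<in>UNIV - {i}. (norm (row j A))\<^sup>2)"
    unfolding active_mass_def using assms by (intro sum_mono2) (auto simp: active_rows_def)
  then show ?thesis using max_deleted_mass_ge[of A i] by linarith
qed

lemma kaczmarz_step_solution:
  fixes A :: "real^'n^'m"
  assumes "A *v s = b"
  shows "kaczmarz_step A b i s = s"
  unfolding kaczmarz_step_def by (simp add: residual_error[OF assms])

text \<open>With \<open>b = A *v z\<close>, the identity \<open>A ** pinv A ** A = A\<close> shows
  that \<open>s\<close> is a solution. The error is \<open>pinv A ** A\<close> applied to
  \<open>y - z\<close>, and symmetry of this product lets it be rewritten with
  \<open>transpose A\<close> in front.\<close>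

lemma pinv_projection:
  fixes A :: "real^'n^'m"
  assumes "\<exists>z. A *v z = b"
    and s: "s = pinv A *v b + (mat 1 - pinv A ** A) *v y"
  shows "A *v s = b" "y - s \<in> row_space A"
proof -
  obtain z where z: "A *v z = b" using assms by blast
  have p: "A ** pinv A ** A = A" "transpose (pinv A ** A) = pinv A ** A"
    using is_pinv_pinv[of A] unfolding is_pinv_def by auto
  have AXA: "A *v (pinv A *v (A *v u)) = A *v u" for u
    using p(1) by (metis matrix_vector_mul_assoc)
  have s': "s = pinv A *v b + (y - pinv A *v (A *v y))"
    unfolding s by (simp add: matrix_vector_mult_diff_rdistrib matrix_vector_mul_assoc)
  show "A *v s = b"
    unfolding s' z[symmetric]
    by (simp add: matrix_vector_right_distrib matrix_vector_mult_diff_distrib AXA)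
  have "y - s = (pinv A ** A) *v (y - z)"
    unfolding s' z[symmetric]
    by (simp add: matrix_vector_mult_diff_distrib matrix_vector_mul_assoc)
  also have "\<dots> = transpose A *v (transpose (pinv A) *v (y - z))"
    by (metis p(2) matrix_transpose_mul matrix_vector_mul_assoc)
  finally show "y - s \<in> row_space A" by blast
qed

section \<open>Decay of the error along the iterates\<close>

theorem corollary2p3:
  fixes A :: "real^'n^'m" and b :: "real^'m" and x0 xstar :: "real^'n"
    and x :: "nat \<Rightarrow> real^'n" and \<gamma> :: real and k :: nat
  assumes "\<And>i. row i A \<noteq> 0"
    and "\<exists>z. A *v z = b"
    and "xstar = pinv A *v b + (mat 1 - pinv A ** A) *v x0"
    and "igrk_sequence A b x" and "x 0 = x0"
    and "\<gamma> = max_deleted_mass A"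
    and "k \<ge> 1"
  shows "(norm (x k - xstar))\<^sup>2 \<le>
           (1 - (sigma_min A)\<^sup>2 / \<gamma>) ^ (k - 1) *
           (1 - (sigma_min A)\<^sup>2 / (frobenius_norm A)\<^sup>2) * (norm (x0 - xstar))\<^sup>2"
proof -
  note nz = assms(1)
  note s = pinv_projection[OF assms(2,3)]
  obtain i where i: "\<And>n. i n \<in> greedy_rows A b (x n)"
    and step: "\<And>n. x (Suc n) = kaczmarz_step A b (i n) (x n)"
    using assms(4) unfolding igrk_sequence_iff by metis
  have V: "x n - xstar \<in> row_space A" for n
    by (induction n) (use s(2) assms(5) in \<open>auto simp only: step intro: kaczmarz_step_row_space\<close>)
  define c d where "c = 1 - (sigma_min A)\<^sup>2 / \<gamma>" and "d = 1 - (sigma_min A)\<^sup>2 / (frobenius_norm A)\<^sup>2"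
  have fix_sol: "x (Suc n) = xstar" if "x n = xstar" for n
    using kaczmarz_step_solution[OF s(1)] step that by simp
  have one: "(norm (x 1 - xstar))\<^sup>2 \<le> d * (norm (x0 - xstar))\<^sup>2"
  proof (cases "x0 = xstar")
    case True
    then show ?thesis using fix_sol[of 0] assms(5) by simp
  next
    case False
    then show ?thesis unfolding d_def
      using greedy_step_contraction[OF nz s(1) i V _ active_mass_le_frobenius, of 0] step[of 0]
        assms(5) by simp
  qed
  \<comment> \<open>The factor \<open>c\<close> needs a row just used, so it is available only from
    \<open>x 1\<close> on; hence the exponent \<open>k - 1\<close>.\<close>
  have later: "(norm (x (Suc (Suc n)) - xstar))\<^sup>2 \<le> c * (norm (x (Suc n) - xstar))\<^sup>2" for n
  proof (cases "x (Suc n) = xstar")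
    case True
    then show ?thesis using fix_sol[of "Suc n"] by simp
  next
    case False
    have "residual A b (x (Suc n)) (i n) = 0"
      unfolding step by (rule residual_after_step[OF nz])
    then show ?thesis unfolding c_def assms(6)
      using greedy_step_contraction[OF nz s(1) i V False active_mass_le_max_deleted] step by metis
  qed
  have F: "(frobenius_norm A)\<^sup>2 > 0"
    unfolding frobenius_norm_rows using nz by (intro sum_pos) auto
  have \<gamma>: "\<gamma> \<ge> 0"
  proof -
    have "0 \<le> (\<Sum>j\<in>UNIV - {i 0}. (norm (row j A))\<^sup>2)" by (simp add: sum_nonneg)
    then show ?thesis using max_deleted_mass_ge[of A "i 0"] assms(6) by linarith
  qed
  \<comment> \<open>For \<open>\<gamma> = 0\<close> the quotient in \<open>c\<close> is 0 in HOL, so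
    that \<open>c = 1\<close>.\<close>
  have cases: "c \<ge> 0 \<or> d = 0"
    using sigma_min_sq_cases[OF nz] F \<gamma> unfolding c_def d_def assms(6)
    by (auto simp: divide_le_eq_1)
  have "(norm (x (Suc n) - xstar))\<^sup>2 \<le> c ^ n * (d * (norm (x0 - xstar))\<^sup>2)" for n
  proof (cases "d = 0")
    case True
    \<comment> \<open>Here the first step already reaches \<open>xstar\<close>, where the iteration
      stays; the sign of \<open>c\<close> is then irrelevant.\<close>
    have "x (Suc n) = xstar"
      by (induction n) (use one True fix_sol in auto)
    then show ?thesis using True by simp
  next
    case False
    \<comment> \<open>Nonnegativity allows the induction hypothesis to be multiplied by
      \<open>c\<close>.\<close>
    then have c: "c \<ge> 0" using cases by simp
    show ?thesis
    proof (induction n)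
      case 0
      then show ?case using one by simp
    next
      case (Suc n)
      then show ?case
        using later[of n] mult_left_mono[OF Suc c] by (simp add: algebra_simps)
    qed
  qed
  from this[of "k - 1"] show ?thesis
    using assms(7) unfolding c_def d_def by (simp add: mult.assoc)
qed

end
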